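(* Let $f\in L_2[0,1]$ be a self-similar function, and let $n$, $a_k$ and $d_k$ ($k=1,\dots,n$) be its self-similarity parameters. Suppose that at least two of the numbers $d_k$ are nonzero. Then there exists a unique positive solution $D$ of the equation $$\sum_{k=1}^n(a_k|d_k|)^{D/2}=1.$$ Moreover, $D<2$.
   Context: Let $n>1$ be a natural number and let $a_k>0$, $d_k$, $\beta_k$ ($k=1,\dots,n$) be real numbers with $\sum_{k=1}^n a_k=1$. Put $\alpha_1=0$, $\alpha_k=\sum_{l=1}^{k-1}a_l$ for $k=2,\dots,n+1$. The similarity operator $G:L_2[0,1]\to L_2[0,1]$ is $$G(f)=\sum_{k=1}^n\{\beta_k\,\chi_{(\alpha_k,\alpha_{k+1})}+d_k\,G_k(f)\},$$ where $\chi_\Gamma$ is the characteristic function of the interval $\Gamma$ and $G_k$ is the continuous linear operator on $L_2[0,1]$ determined by $G_k(\chi_{(\zeta,\xi)})=\chi_{(\alpha_k+a_k\zeta,\,\alpha_k+a_k\xi)}$ for all $(\zeta,\xi)\subset[0,1]$; that is, $(G_kf)(x)=f((x-\alpha_k)/a_k)$ for $x\in(\alpha_k,\alpha_{k+1})$ and $(G_kf)(x)=0$ otherwise. It is always assumed that $\sum_{k=1}^n a_k|d_k|^2<1$. A function $f\in L_2[0,1]$ with $G(f)=f$ is called self-similar, and $n,a_k,d_k,\beta_k$ are called its self-similarity parameters. Convention: $0^x=0$ for $x>0$. *)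

theory Defs
  imports "HOL-Analysis.Analysis"
begin

text \<open>
  Elements of \<open>L\<^sub>2[0,1]\<close> are represented by square-integrable functions; equality in
  \<open>L\<^sub>2[0,1]\<close> is equality almost everywhere on the unit interval. The lemmas below show that
  the similarity operator preserves square-integrability and respects this equality, so it is
  an operator on \<open>L\<^sub>2[0,1]\<close>. All families are indexed by \<open>1, \<dots>, n\<close>; their values at other
  indices are irrelevant.
\<close>

definition L2_unit :: "(real \<Rightarrow> real) set" where
  "L2_unit = {f. f \<in> borel_measurable (lebesgue_on {0..1}) \<and>
                 integrable (lebesgue_on {0..1}) (\<lambda>x. (f x)\<^sup>2)}"

definition L2_eq :: "(real \<Rightarrow> real) \<Rightarrow> (real \<Rightarrow> real) \<Rightarrow> bool" where
  "L2_eq f g \<longleftrightarrow> (AE x in lebesgue_on {0..1}. f x = g x)"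

definition knot :: "(nat \<Rightarrow> real) \<Rightarrow> nat \<Rightarrow> real" where
  "knot a k = (\<Sum>l = 1..<k. a l)"

definition sim_piece :: "(nat \<Rightarrow> real) \<Rightarrow> nat \<Rightarrow> (real \<Rightarrow> real) \<Rightarrow> real \<Rightarrow> real" where
  "sim_piece a k f x =
     (if x \<in> {knot a k <..< knot a (Suc k)} then f ((x - knot a k) / a k) else 0)"

definition sim_op ::
  "nat \<Rightarrow> (nat \<Rightarrow> real) \<Rightarrow> (nat \<Rightarrow> real) \<Rightarrow> (nat \<Rightarrow> real) \<Rightarrow> (real \<Rightarrow> real) \<Rightarrow> real \<Rightarrow> real" where
  "sim_op n a d \<beta> f x =
     (\<Sum>k = 1..n. \<beta> k * indicator {knot a k <..< knot a (Suc k)} x + d k * sim_piece a k f x)"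

definition sim_parameters :: "nat \<Rightarrow> (nat \<Rightarrow> real) \<Rightarrow> (nat \<Rightarrow> real) \<Rightarrow> bool" where
  "sim_parameters n a d \<longleftrightarrow>
     n > 1 \<and> (\<forall>k\<in>{1..n}. a k > 0) \<and> (\<Sum>k = 1..n. a k) = 1 \<and> (\<Sum>k = 1..n. a k * \<bar>d k\<bar>\<^sup>2) < 1"

definition self_similar ::
  "nat \<Rightarrow> (nat \<Rightarrow> real) \<Rightarrow> (nat \<Rightarrow> real) \<Rightarrow> (nat \<Rightarrow> real) \<Rightarrow> (real \<Rightarrow> real) \<Rightarrow> bool" where
  "self_similar n a d \<beta> f \<longleftrightarrow>
     sim_parameters n a d \<and> f \<in> L2_unit \<and> L2_eq (sim_op n a d \<beta> f) f"

lemma knot_Suc: "k \<ge> 1 \<Longrightarrow> knot a (Suc k) = knot a k + a k"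
  by (simp add: knot_def)

text \<open>The property by which the operators \<open>G\<^sub>k\<close> are determined.\<close>

lemma sim_piece_indicator:
  assumes "k \<ge> 1" "a k > 0" "0 \<le> \<zeta>" "\<xi> \<le> 1"
  shows "sim_piece a k (indicator {\<zeta> <..< \<xi>}) =
         indicator {knot a k + a k * \<zeta> <..< knot a k + a k * \<xi>}"
proof
  fix x
  have eq: "(x - knot a k) / a k \<in> {\<zeta> <..< \<xi>} \<longleftrightarrow>
        x \<in> {knot a k + a k * \<zeta> <..< knot a k + a k * \<xi>}"
    using assms(2) by (auto simp: field_simps)
  have "a k * \<xi> \<le> a k" "0 \<le> a k * \<zeta>"
    using assms by (simp_all add: mult_left_le)
  then have "x \<in> {knot a k + a k * \<zeta> <..< knot a k + a k * \<xi>} \<Longrightarrow>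
        x \<in> {knot a k <..< knot a (Suc k)}"
    using knot_Suc[OF assms(1), of a] by auto
  with eq show "sim_piece a k (indicator {\<zeta> <..< \<xi>}) x =
         indicator {knot a k + a k * \<zeta> <..< knot a k + a k * \<xi>} x"
    unfolding sim_piece_def indicator_def by auto
qed

lemma sim_piece_affine:
  assumes "k \<ge> 1" "a k > 0"
  shows "sim_piece a k f x =
         indicator {0<..<1} (- knot a k / a k + 1 / a k * x) * f (- knot a k / a k + 1 / a k * x)"
proof -
  have *: "- knot a k / a k + 1 / a k * x = (x - knot a k) / a k"
    by (simp add: diff_divide_distrib)
  have "x \<in> {knot a k <..< knot a (Suc k)} \<longleftrightarrow> (x - knot a k) / a k \<in> {0<..<1}"
    using assms knot_Suc[OF assms(1), of a] by (auto simp: field_simps)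
  then show ?thesis
    unfolding * sim_piece_def indicator_def by auto
qed

lemma AE_lebesgue_affine:
  fixes P :: "real \<Rightarrow> bool"
  assumes "c \<noteq> 0" "AE x in lebesgue. P x"
  shows "AE x in lebesgue. P (t + c * x)"
proof -
  obtain N where N: "N \<in> null_sets lebesgue" "{x. \<not> P x} \<subseteq> N"
    using assms(2) by (auto simp: eventually_ae_filter)
  have sub: "{x. \<not> P (t + c * x)} \<subseteq> (\<lambda>y. (1 / c) *\<^sub>R y + (- t / c)) ` N"
  proof
    fix x assume "x \<in> {x. \<not> P (t + c * x)}"
    then have "t + c * x \<in> N" using N by auto
    moreover have "x = (1 / c) *\<^sub>R (t + c * x) + (- t / c)"
      using assms(1) by (simp add: field_simps)
    ultimately show "x \<in> (\<lambda>y. (1 / c) *\<^sub>R y + (- t / c)) ` N" by blast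
  qed
  have "negligible ((\<lambda>y. (1 / c) *\<^sub>R y + (- t / c)) ` N)"
    using N(1) by (intro negligible_differentiable_image_negligible)
      (auto simp: negligible_iff_null_sets divide_inverse intro!: derivative_intros)
  then show ?thesis
    using sub by (auto simp: eventually_ae_filter negligible_iff_null_sets)
qed

lemma sim_op_respects_L2_eq:
  assumes "sim_parameters n a d" "L2_eq f g"
  shows "L2_eq (sim_op n a d \<beta> f) (sim_op n a d \<beta> g)"
proof -
  have fg: "AE x in lebesgue. x \<in> {0..1} \<longrightarrow> f x = g x"
    using assms(2) by (simp add: L2_eq_def AE_restrict_space_iff)
  have "AE x in lebesgue. sim_piece a k f x = sim_piece a k g x" if k: "k \<in> {1..n}" for k
  proof -
    have a: "k \<ge> 1" "a k > 0" using k assms(1) by (auto simp: sim_parameters_def)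
    have "AE x in lebesgue. - knot a k / a k + 1 / a k * x \<in> {0..1} \<longrightarrow>
        f (- knot a k / a k + 1 / a k * x) = g (- knot a k / a k + 1 / a k * x)"
      using a by (intro AE_lebesgue_affine[OF _ fg]) auto
    then show ?thesis
      unfolding sim_piece_affine[where a = a, OF a]
      by (rule AE_mp, intro AE_I2 impI) (auto simp: indicator_def)
  qed
  then have "AE x in lebesgue. \<forall>k\<in>{1..n}. sim_piece a k f x = sim_piece a k g x"
    by (intro AE_finite_allI) auto
  then have "AE x in lebesgue. sim_op n a d \<beta> f x = sim_op n a d \<beta> g x"
    by (rule AE_mp, intro AE_I2 impI) (simp add: sim_op_def)
  then show ?thesis
    unfolding L2_eq_def by (auto simp: AE_restrict_space_iff elim: eventually_mono)
qed

lemma square_integrable_sum: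
  fixes h :: "nat \<Rightarrow> real \<Rightarrow> real"
  assumes "finite A"
    and "\<And>k. k \<in> A \<Longrightarrow> h k \<in> borel_measurable M \<and> integrable M (\<lambda>x. (h k x)\<^sup>2)"
  shows "(\<lambda>x. \<Sum>k\<in>A. h k x) \<in> borel_measurable M \<and> integrable M (\<lambda>x. (\<Sum>k\<in>A. h k x)\<^sup>2)"
  using assms
proof (induction A rule: finite_induct)
  case (insert j A)
  let ?S = "\<lambda>x. \<Sum>k\<in>A. h k x"
  have hj [measurable]: "h j \<in> borel_measurable M" and S [measurable]: "?S \<in> borel_measurable M"
    and int: "integrable M (\<lambda>x. (h j x)\<^sup>2)" "integrable M (\<lambda>x. (?S x)\<^sup>2)"
    using insert by auto
  have bound: "(u + v)\<^sup>2 \<le> 2 * u\<^sup>2 + 2 * v\<^sup>2" for u v :: real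
    using zero_le_power2[of "u - v"] by (simp add: power2_sum power2_diff)
  have "integrable M (\<lambda>x. (h j x + ?S x)\<^sup>2)"
  proof (rule Bochner_Integration.integrable_bound)
    show "integrable M (\<lambda>x. 2 * (h j x)\<^sup>2 + 2 * (?S x)\<^sup>2)"
      using int by simp
  qed (use bound in auto)
  moreover have "(\<lambda>x. h j x + ?S x) \<in> borel_measurable M" by measurable
  ultimately show ?case using insert.hyps by simp
qed simp

lemma sim_piece_square_integrable:
  assumes "k \<ge> 1" "a k > 0" "f \<in> L2_unit"
  shows "sim_piece a k f \<in> borel_measurable lebesgue"
    and "integrable lebesgue (\<lambda>x. (sim_piece a k f x)\<^sup>2)"
proof -
  define \<psi> where "\<psi> = (\<lambda>x. indicator {0<..<1} x * f x)"
  define t where "t = - knot a k / a k"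
  define c where "c = 1 / a k"
  have f: "(\<lambda>x. indicator {0..1} x * f x) \<in> borel_measurable lebesgue"
    "integrable lebesgue (\<lambda>x. indicator {0..1} x * (f x)\<^sup>2)"
    using assms(3)
    by (simp_all add: L2_unit_def borel_measurable_restrict_space_iff integrable_restrict_space)
  have "(\<lambda>x. indicator {0<..<1} x * (indicator {0..1} x * f x)) \<in> borel_measurable lebesgue"
    by (rule borel_measurable_times[OF _ f(1)]) (auto intro!: borel_measurable_indicator)
  also have "(\<lambda>x. indicator {0<..<1} x * (indicator {0..1} x * f x)) = \<psi>"
    by (auto simp: \<psi>_def indicator_def)
  finally have meas: "\<psi> \<in> borel_measurable lebesgue" .
  have "integrable lebesgue (\<lambda>x. indicator {0..1} x * (f x)\<^sup>2 * indicator {0<..<1} x)"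
    using f(2) by (intro integrable_real_mult_indicator) auto
  also have "(\<lambda>x. indicator {0..1} x * (f x)\<^sup>2 * indicator {0<..<1} x) = (\<lambda>x. (\<psi> x)\<^sup>2)"
    by (auto simp: \<psi>_def indicator_def)
  finally have int: "integrable lebesgue (\<lambda>x. (\<psi> x)\<^sup>2)" .
  have c: "c \<noteq> 0" using assms(2) by (simp add: c_def)
  have sim: "sim_piece a k f = (\<lambda>x. \<psi> (t + c * x))"
    using sim_piece_affine[where a = a and k = k, OF assms(1,2)]
    by (auto simp: \<psi>_def t_def c_def)
  have "(\<lambda>x. t + c * x) \<in> lebesgue \<rightarrow>\<^sub>M lebesgue"
    using lebesgue_affine_measurable[where c = "\<lambda>x::real. c"] c by simp
  then show "sim_piece a k f \<in> borel_measurable lebesgue"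
    unfolding sim by (rule measurable_compose) (rule meas)
  show "integrable lebesgue (\<lambda>x. (sim_piece a k f x)\<^sup>2)"
    unfolding sim by (rule lebesgue_integrable_real_affine[OF int c])
qed

lemma sim_op_in_L2_unit:
  assumes "sim_parameters n a d" "f \<in> L2_unit"
  shows "sim_op n a d \<beta> f \<in> L2_unit"
proof -
  let ?M = "lebesgue_on {0..1::real}"
  let ?I = "\<lambda>k. {knot a k <..< knot a (Suc k)}"
  have ind: "(\<lambda>x. \<beta> k * indicator (?I k) x) \<in> borel_measurable lebesgue"
    "integrable lebesgue (\<lambda>x. (\<beta> k * indicator (?I k) x)\<^sup>2)" for k
  proof -
    have "integrable lebesgue (\<lambda>x. (\<beta> k)\<^sup>2 * indicator (?I k) x)"
      by (intro integrable_mult_right integrable_real_indicator)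
        (use emeasure_bounded_finite[of "?I k"] in auto)
    also have "(\<lambda>x. (\<beta> k)\<^sup>2 * indicator (?I k) x) = (\<lambda>x. (\<beta> k * indicator (?I k) x)\<^sup>2)"
      by (auto simp: indicator_def)
    finally show "integrable lebesgue (\<lambda>x. (\<beta> k * indicator (?I k) x)\<^sup>2)" .
  qed (auto intro!: borel_measurable_times borel_measurable_indicator)
  have piece: "(\<lambda>x. d k * sim_piece a k f x) \<in> borel_measurable lebesgue"
    "integrable lebesgue (\<lambda>x. (d k * sim_piece a k f x)\<^sup>2)" if "k \<in> {1..n}" for k
    using sim_piece_square_integrable[of k a f] that assms
    by (auto simp: sim_parameters_def power_mult_distrib)
  have "(\<lambda>x. \<Sum>k = 1..n. \<beta> k * indicator (?I k) x) \<in> borel_measurable lebesgue \<and>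
      integrable lebesgue (\<lambda>x. (\<Sum>k = 1..n. \<beta> k * indicator (?I k) x)\<^sup>2)"
    using ind by (intro square_integrable_sum) auto
  moreover have "(\<lambda>x. \<Sum>k = 1..n. d k * sim_piece a k f x) \<in> borel_measurable lebesgue \<and>
      integrable lebesgue (\<lambda>x. (\<Sum>k = 1..n. d k * sim_piece a k f x)\<^sup>2)"
    using piece by (intro square_integrable_sum) auto
  ultimately have
    "(\<lambda>x. \<Sum>j\<in>{0,1::nat}. if j = 0 then \<Sum>k = 1..n. \<beta> k * indicator (?I k) x
         else \<Sum>k = 1..n. d k * sim_piece a k f x) \<in> borel_measurable lebesgue \<and>
     integrable lebesgue (\<lambda>x. (\<Sum>j\<in>{0,1::nat}. if j = 0 then \<Sum>k = 1..n. \<beta> k * indicator (?I k) x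
         else \<Sum>k = 1..n. d k * sim_piece a k f x)\<^sup>2)"
    by (intro square_integrable_sum) auto
  then have "sim_op n a d \<beta> f \<in> borel_measurable lebesgue"
    "integrable lebesgue (\<lambda>x. (sim_op n a d \<beta> f x)\<^sup>2)"
    by (simp_all add: sim_op_def[abs_def] sum.distrib)
  then show ?thesis
    unfolding L2_unit_def
    by (auto intro!: measurable_restrict_space1
        simp: integrable_restrict_space mult.commute[of "indicator _ _"]
        intro: integrable_real_mult_indicator)
qed

end

theory Submission
  imports Defs
begin

text \<open>
  Put \<open>c\<^sub>k = a\<^sub>k \<bar>d\<^sub>k\<bar>\<close>. Averaging \<open>\<bar>d\<bar> \<le> (1 + \<bar>d\<bar>\<^sup>2) / 2\<close> with the weights \<open>a\<^sub>k\<close> gives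
  \<open>\<Sum>k. c\<^sub>k \<le> (1 + \<Sum>k. a\<^sub>k \<bar>d\<^sub>k\<bar>\<^sup>2) / 2 < 1\<close>; in particular every nonzero \<open>c\<^sub>k\<close> lies in \<open>(0, 1)\<close>.
  Over the indices with \<open>d\<^sub>k \<noteq> 0\<close>, the function \<open>s \<mapsto> \<Sum>k. c\<^sub>k powr s\<close> is therefore continuous and
  strictly decreasing. It is at least 2 at \<open>s = 0\<close>, where it counts these indices, and less
  than 1 at \<open>s = 1\<close>, so it takes the value 1 at exactly one real number \<open>s\<close>, which lies in \<open>(0, 1)\<close>.
  The solution is \<open>D = 2 * s\<close>.
\<close>

lemma sum_powr_strict_antimono:
  fixes c :: "'a \<Rightarrow> real"
  assumes "finite S" "S \<noteq> {}" "\<And>k. k \<in> S \<Longrightarrow> 0 < c k \<and> c k < 1" "s < t"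
  shows "(\<Sum>k\<in>S. c k powr t) < (\<Sum>k\<in>S. c k powr s)"
  using assms by (intro sum_strict_mono powr_less_mono') auto

lemma sum_powr_eq_1_ex1:
  fixes c :: "'a \<Rightarrow> real"
  assumes card: "card S \<ge> 2" and pos: "\<And>k. k \<in> S \<Longrightarrow> 0 < c k" and sum: "(\<Sum>k\<in>S. c k) < 1"
  obtains s where "0 < s" "s < 1" "\<And>t. (\<Sum>k\<in>S. c k powr t) = 1 \<longleftrightarrow> t = s"
proof -
  define F where "F t = (\<Sum>k\<in>S. c k powr t)" for t
  have fin: "finite S"
    using card by (metis card.infinite not_numeral_le_zero)
  have ne: "S \<noteq> {}"
    using card by auto
  have c1: "0 < c k \<and> c k < 1" if "k \<in> S" for k
    using member_le_sum[of k S c] that fin pos sum by fastforce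
  have dec: "F t < F s" if "s < t" for s t
    unfolding F_def by (rule sum_powr_strict_antimono[OF fin ne c1 that])
  have F0: "F 0 \<ge> 2"
    using card pos by (simp add: F_def powr_zero_eq_one less_imp_neq [symmetric])
  have F1: "F 1 < 1"
    using sum pos by (simp add: F_def less_imp_le)
  have "continuous_on {0..1} F"
    unfolding F_def using pos by (intro continuous_intros) force
  then obtain s where s: "0 \<le> s" "s \<le> 1" "F s = 1"
    using IVT2'[of F 1 1 0] F0 F1 by auto
  have "s \<noteq> 0" "s \<noteq> 1"
    using s F0 F1 by auto
  with s have "0 < s" "s < 1"
    by auto
  moreover have "F t = 1 \<longleftrightarrow> t = s" for t
    using dec[of s t] dec[of t s] s(3) by (cases t s rule: linorder_cases) auto
  ultimately show thesis
    using that unfolding F_def by blast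
qed

lemma sim_parameters_sum_less_1:
  assumes "sim_parameters n a d"
  shows "(\<Sum>k = 1..n. a k * \<bar>d k\<bar>) < 1"
proof -
  have a: "a k > 0" if "k \<in> {1..n}" for k
    using assms that by (auto simp: sim_parameters_def)
  have "\<bar>x\<bar> \<le> (1 + \<bar>x\<bar>\<^sup>2) / 2" for x :: real
    using zero_le_power2[of "1 - \<bar>x\<bar>"] by (simp add: power2_diff)
  then have "(\<Sum>k = 1..n. a k * \<bar>d k\<bar>) \<le> (\<Sum>k = 1..n. a k * ((1 + \<bar>d k\<bar>\<^sup>2) / 2))"
    using a by (intro sum_mono mult_left_mono) (auto simp: less_imp_le)
  also have "\<dots> = ((\<Sum>k = 1..n. a k) + (\<Sum>k = 1..n. a k * \<bar>d k\<bar>\<^sup>2)) / 2"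
    unfolding sum.distrib [symmetric] sum_divide_distrib
    by (intro sum.cong) (auto simp: algebra_simps)
  also have "\<dots> < 1"
    using assms by (simp add: sim_parameters_def)
  finally show ?thesis .
qed

theorem mainTheorem6:
  fixes n :: nat and a d \<beta> :: "nat \<Rightarrow> real" and f :: "real \<Rightarrow> real"
  assumes "self_similar n a d \<beta> f"
    and "card {k \<in> {1..n}. d k \<noteq> 0} \<ge> 2"
  shows "(\<exists>!D::real. D > 0 \<and> (\<Sum>k = 1..n. (a k * \<bar>d k\<bar>) powr (D / 2)) = 1) \<and>
    (\<forall>D::real. D > 0 \<and> (\<Sum>k = 1..n. (a k * \<bar>d k\<bar>) powr (D / 2)) = 1 \<longrightarrow> D < 2)"
proof -
  let ?S = "{k \<in> {1..n}. d k \<noteq> 0}"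
  have par: "sim_parameters n a d"
    using assms(1) by (simp add: self_similar_def)
  have pos: "0 < a k * \<bar>d k\<bar>" if "k \<in> ?S" for k
    using par that by (auto simp: sim_parameters_def)
  have restrict_sum: "(\<Sum>k = 1..n. (a k * \<bar>d k\<bar>) powr t) = (\<Sum>k\<in>?S. (a k * \<bar>d k\<bar>) powr t)" for t
    by (intro sum.mono_neutral_right) auto
  have "(\<Sum>k\<in>?S. a k * \<bar>d k\<bar>) = (\<Sum>k = 1..n. a k * \<bar>d k\<bar>)"
    by (intro sum.mono_neutral_left) auto
  then have "(\<Sum>k\<in>?S. a k * \<bar>d k\<bar>) < 1"
    using sim_parameters_sum_less_1[OF par] by simp
  then obtain s where s: "0 < s" "s < 1"
    and "\<And>t. (\<Sum>k\<in>?S. (a k * \<bar>d k\<bar>) powr t) = 1 \<longleftrightarrow> t = s"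
    using sum_powr_eq_1_ex1[where c = "\<lambda>k. a k * \<bar>d k\<bar>", OF assms(2) pos] by blast
  then have "(\<Sum>k = 1..n. (a k * \<bar>d k\<bar>) powr (D / 2)) = 1 \<longleftrightarrow> D = 2 * s" for D
    unfolding restrict_sum by auto
  then show ?thesis
    using s by auto
qed

end
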